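(* Let $n\ge1$ and $k$ be natural numbers, $0\le t\le n$, $0<\epsilon<1$, and let $\mathcal{R}$ be a finite nonempty set. Let $\mathrm{Enc}\colon\{0,1\}^k\times\mathcal{R}\to\{0,1\}^n$ be a private code that is $(t,\epsilon)$-resilient in the oblivious scenario, or $(t,\epsilon)$-resilient in the Hamming scenario. Then $$\frac{k}{n}\le 1-\frac{t}{n}+\frac{1+\log(1/(1-\epsilon))}{n}.$$
   Context: Logarithms are base 2. A private code is a function $\mathrm{Enc}\colon\mathcal{M}\times\mathcal{R}\to\mathcal{X}$, with $\mathrm{Enc}_\rho(m)=\mathrm{Enc}(m,\rho)$; a decoding function receives the same $\rho$, with $\mathrm{Dec}_\rho(\tilde x)=\mathrm{Dec}(\tilde x,\rho)$. Probabilities are over $\rho$ uniform in $\mathcal{R}$. The set $\{0,1\}^n$ is viewed as the additive group $(\mathbb{F}_2)^n$. Oblivious scenario: $\mathrm{Enc}$ is $(t,\epsilon)$-resilient in the oblivious scenario if for every $E\subseteq\mathcal{X}$ of size at most $2^t$ there exists $\mathrm{Dec}\colon\mathcal{X}\times\mathcal{R}\to\mathcal{M}$ such that for all $m\in\mathcal{M}$ and $e\in E$, $\Pr_\rho[\mathrm{Dec}_\rho(\mathrm{Enc}_\rho(m)+e)=m]\ge1-\epsilon$. Hamming scenario: a Hamming channel from $\mathcal{X}$ to $\widetilde{\mathcal{X}}$ is a bipartite graph with left set $\mathcal{X}$, right set $\widetilde{\mathcal{X}}$ and all left degrees at least 1. Its distortion is the maximal right degree. A channel function is a map $\mathrm{Ch}\colon\mathcal{X}\to\widetilde{\mathcal{X}}$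 with $(x,\mathrm{Ch}(x))$ an edge for every $x$. $\mathrm{Enc}$ is $(t,\epsilon)$-resilient in the Hamming scenario if for every $\widetilde{\mathcal{X}}$ and every Hamming channel from $\mathcal{X}$ to $\widetilde{\mathcal{X}}$ with distortion at most $2^t$ there exists $\mathrm{Dec}\colon\widetilde{\mathcal{X}}\times\mathcal{R}\to\mathcal{M}$ such that for all channel functions $\mathrm{Ch}$ of this channel and all $m\in\mathcal{M}$, $\Pr_\rho[\mathrm{Dec}_\rho(\mathrm{Ch}(\mathrm{Enc}_\rho(m)))=m]\ge1-\epsilon$. *)

theory Defs
  imports "HOL-Probability.Probability" "HOL-Library.Z2" "HOL-Library.Function_Algebras"
begin

text \<open>
  Words of length \<open>n\<close> over the field \<open>bit\<close> with two elements, represented as sequences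
  that vanish from position \<open>n\<close> on. This is a subgroup of \<open>nat \<Rightarrow> bit\<close> under the pointwise
  addition of Function_Algebras, namely the additive group of vectors of length \<open>n\<close> over
  the field with two elements.
\<close>

definition words :: "nat \<Rightarrow> (nat \<Rightarrow> bit) set" where
  "words n = {x. \<forall>i\<ge>n. x i = 0}"

definition private_code :: "'m set \<Rightarrow> 'r set \<Rightarrow> 'x set \<Rightarrow> ('m \<times> 'r \<Rightarrow> 'x) \<Rightarrow> bool" where
  "private_code M R X Enc \<longleftrightarrow> Enc \<in> M \<times> R \<rightarrow> X"

text \<open>
  In both scenarios the probability is over \<open>\<rho>\<close> uniform in \<open>R\<close>, which is meaningful for
  finite nonempty \<open>R\<close> only.
\<close>

definition oblivious_resilient ::
  "'m set \<Rightarrow> 'r set \<Rightarrow> 'x::ab_group_add set \<Rightarrow> real \<Rightarrow> real \<Rightarrow> ('m \<times> 'r \<Rightarrow> 'x) \<Rightarrow> bool" where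
  "oblivious_resilient M R X t \<epsilon> Enc \<longleftrightarrow>
     (\<forall>E\<subseteq>X. finite E \<and> real (card E) \<le> 2 powr t \<longrightarrow>
       (\<exists>Dec \<in> X \<times> R \<rightarrow> M. \<forall>m\<in>M. \<forall>e\<in>E.
          measure_pmf.prob (pmf_of_set R) {\<rho>. Dec (Enc (m, \<rho>) + e, \<rho>) = m} \<ge> 1 - \<epsilon>))"

definition hamming_channel :: "'x set \<Rightarrow> 'y set \<Rightarrow> ('x \<times> 'y) set \<Rightarrow> bool" where
  "hamming_channel X Y G \<longleftrightarrow> G \<subseteq> X \<times> Y \<and> (\<forall>x\<in>X. \<exists>y\<in>Y. (x, y) \<in> G)"

text \<open>
  For a channel from a finite nonempty \<open>X\<close> the set of right degrees is finite and nonempty,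
  even if \<open>Y\<close> is infinite.
\<close>

definition distortion :: "'x set \<Rightarrow> 'y set \<Rightarrow> ('x \<times> 'y) set \<Rightarrow> nat" where
  "distortion X Y G = Max ((\<lambda>y. card {x \<in> X. (x, y) \<in> G}) ` Y)"

definition channel_function :: "'x set \<Rightarrow> 'y set \<Rightarrow> ('x \<times> 'y) set \<Rightarrow> ('x \<Rightarrow> 'y) \<Rightarrow> bool" where
  "channel_function X Y G Ch \<longleftrightarrow> Ch \<in> X \<rightarrow> Y \<and> (\<forall>x\<in>X. (x, Ch x) \<in> G)"

definition decodable_over ::
  "'m set \<Rightarrow> 'r set \<Rightarrow> 'x set \<Rightarrow> real \<Rightarrow> ('m \<times> 'r \<Rightarrow> 'x) \<Rightarrow> 'y set \<Rightarrow> ('x \<times> 'y) set \<Rightarrow> bool" where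
  "decodable_over M R X \<epsilon> Enc Y G \<longleftrightarrow>
     (\<exists>Dec \<in> Y \<times> R \<rightarrow> M. \<forall>Ch. channel_function X Y G Ch \<longrightarrow>
        (\<forall>m\<in>M. measure_pmf.prob (pmf_of_set R) {\<rho>. Dec (Ch (Enc (m, \<rho>)), \<rho>) = m} \<ge> 1 - \<epsilon>))"

text \<open>
  A HOL definition cannot quantify over all types, so the right set \<open>Y\<close> of the channel ranges
  over sets of natural numbers. For finite \<open>X\<close> nothing is lost: the lemma
  \<open>hamming_resilient_any_type\<close> derives the same property for right sets in an arbitrary type
  and of any cardinality.
\<close>

definition hamming_resilient ::
  "'m set \<Rightarrow> 'r set \<Rightarrow> 'x set \<Rightarrow> real \<Rightarrow> real \<Rightarrow> ('m \<times> 'r \<Rightarrow> 'x) \<Rightarrow> bool" where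
  "hamming_resilient M R X t \<epsilon> Enc \<longleftrightarrow>
     (\<forall>(Y :: nat set) G. hamming_channel X Y G \<and> real (distortion X Y G) \<le> 2 powr t \<longrightarrow>
        decodable_over M R X \<epsilon> Enc Y G)"

lemma hamming_resilient_any_type:
  fixes X :: "'x set" and Y :: "'y set"
  assumes res: "hamming_resilient M R X t \<epsilon> Enc" and X: "finite X" "X \<noteq> {}"
    and G: "hamming_channel X Y G" and dist: "real (distortion X Y G) \<le> 2 powr t"
  shows "decodable_over M R X \<epsilon> Enc Y G"
proof -
  define N where "N y = {x \<in> X. (x, y) \<in> G}" for y
  obtain c :: "'x set \<Rightarrow> nat" where c: "inj_on c (Pow X)"
    using X(1) finite_imp_inj_to_nat_seg[of "Pow X"] by auto
  define f where "f y = c (N y)" for y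
  define G' where "G' = {(x, f y) | x y. (x, y) \<in> G}"
  have sub: "N y \<in> Pow X" for y by (auto simp: N_def)
  have f_eq: "f y = f z \<longleftrightarrow> N y = N z" for y z
    using inj_on_eq_iff[OF c sub sub] by (simp add: f_def)
  have G_sub: "G \<subseteq> X \<times> Y" using G by (simp add: hamming_channel_def)
  have nb: "{x \<in> X. (x, f y) \<in> G'} = N y" for y
  proof (intro equalityI subsetI)
    fix x assume "x \<in> {x \<in> X. (x, f y) \<in> G'}"
    then obtain z where "x \<in> X" "(x, z) \<in> G" "f y = f z" by (auto simp: G'_def)
    then show "x \<in> N y" using f_eq by (auto simp: N_def)
  next
    fix x assume "x \<in> N y"
    then show "x \<in> {x \<in> X. (x, f y) \<in> G'}" by (auto simp: N_def G'_def)
  qed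
  have "distortion X (f ` Y) G' = distortion X Y G"
    by (simp add: distortion_def image_image nb N_def)
  moreover have "hamming_channel X (f ` Y) G'"
    using G unfolding hamming_channel_def G'_def by blast
  ultimately have "decodable_over M R X \<epsilon> Enc (f ` Y) G'"
    using res dist by (simp add: hamming_resilient_def)
  then obtain D where D: "D \<in> f ` Y \<times> R \<rightarrow> M"
    and D': "\<And>Ch m. channel_function X (f ` Y) G' Ch \<Longrightarrow> m \<in> M \<Longrightarrow>
      measure_pmf.prob (pmf_of_set R) {\<rho>. D (Ch (Enc (m, \<rho>)), \<rho>) = m} \<ge> 1 - \<epsilon>"
    unfolding decodable_over_def by blast
  have "measure_pmf.prob (pmf_of_set R) {\<rho>. D (f (Ch (Enc (m, \<rho>))), \<rho>) = m} \<ge> 1 - \<epsilon>"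
    if "channel_function X Y G Ch" "m \<in> M" for Ch m
  proof -
    have "channel_function X (f ` Y) G' (\<lambda>x. f (Ch x))"
      using that(1) by (auto simp: channel_function_def G'_def)
    from D'[OF this that(2)] show ?thesis .
  qed
  moreover have "(\<lambda>(y, \<rho>). D (f y, \<rho>)) \<in> Y \<times> R \<rightarrow> M" using D by auto
  ultimately show ?thesis
    unfolding decodable_over_def by (intro bexI[of _ "\<lambda>(y, \<rho>). D (f y, \<rho>)"]) auto
qed

end

theory Submission
  imports Defs
begin

text \<open>
  Let \<open>d = \<lfloor>t\<rfloor>\<close>. In the oblivious scenario, take for \<open>E\<close> the \<open>2\<^sup>d\<close> words supported on the
  first \<open>d\<close> positions: for fixed \<open>\<rho>\<close>, a pair \<open>(m, e)\<close> that is decoded correctly can be recovered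
  from the received word, so there are at most \<open>2\<^sup>n\<close> such pairs. In the Hamming scenario, take
  the channel that deletes the first \<open>d\<close> positions: for fixed \<open>\<rho>\<close>, at most \<open>2\<^sup>n\<^sup>-\<^sup>d\<close> messages are
  decoded correctly. Averaging over \<open>\<rho>\<close> gives \<open>2\<^sup>k 2\<^sup>d (1 - \<epsilon>) \<le> 2\<^sup>n\<close> in both cases, and \<open>d > t - 1\<close>.
\<close>

text \<open>Double counting of the pairs (i, \<rho>) in \<open>I\<close> \<times> \<open>R\<close>
  that satisfy \<open>P\<close>: each i has at least \<open>p * card R\<close> partners, each \<rho>
  at most \<open>N\<close>. Dividing by \<open>card R\<close> gives the bound.\<close>

lemma card_mult_le_if_prob_ge:
  fixes P :: "'i \<Rightarrow> 'r \<Rightarrow> bool"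
  assumes R: "finite R" "R \<noteq> {}" and I: "finite I"
    and prob: "\<And>i. i \<in> I \<Longrightarrow> measure_pmf.prob (pmf_of_set R) {\<rho>. P i \<rho>} \<ge> p"
    and bound: "\<And>\<rho>. \<rho> \<in> R \<Longrightarrow> card {i \<in> I. P i \<rho>} \<le> N"
  shows "real (card I) * p \<le> real N"
proof -
  have pos: "real (card R) > 0" using R by (simp add: card_gt_0_iff)
  have "real (card I) * p * real (card R) = (\<Sum>i\<in>I. p * real (card R))" by simp
  also have "\<dots> \<le> (\<Sum>i\<in>I. real (card {\<rho> \<in> R. P i \<rho>}))"
  proof (rule sum_mono)
    fix i assume "i \<in> I"
    from prob[OF this] show "p * real (card R) \<le> real (card {\<rho> \<in> R. P i \<rho>})"
      using pos by (simp add: measure_pmf_of_set[OF R(2,1)] pos_le_divide_eq Int_def)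
  qed
  also have "\<dots> = real (\<Sum>i\<in>I. card {\<rho> \<in> R. P i \<rho>})" by simp
  also have "(\<Sum>i\<in>I. card {\<rho> \<in> R. P i \<rho>}) = (\<Sum>\<rho>\<in>R. card {i \<in> I. P i \<rho>})"
    using sum.swap_restrict[OF I R(1), of "\<lambda>_ _. 1::nat" P] by simp
  also have "real \<dots> \<le> real (card R * N)"
    using sum_bounded_above[of R "\<lambda>\<rho>. card {i \<in> I. P i \<rho>}" N] bound
    by (intro of_nat_mono) simp
  finally show ?thesis using pos by (simp add: mult.commute)
qed

lemma oblivious_resilient_card_le:
  assumes R: "finite R" "R \<noteq> {}" and M: "finite M" and X: "finite X"
    and add: "\<And>x y. x \<in> X \<Longrightarrow> y \<in> X \<Longrightarrow> x + y \<in> X"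
    and code: "private_code M R X Enc" and res: "oblivious_resilient M R X t \<epsilon> Enc"
    and E: "E \<subseteq> X" "real (card E) \<le> 2 powr t"
  shows "real (card M) * real (card E) * (1 - \<epsilon>) \<le> real (card X)"
proof -
  have fE: "finite E" using E(1) X finite_subset by blast
  then have "\<exists>D \<in> X \<times> R \<rightarrow> M. \<forall>m\<in>M. \<forall>e\<in>E.
      measure_pmf.prob (pmf_of_set R) {\<rho>. D (Enc (m, \<rho>) + e, \<rho>) = m} \<ge> 1 - \<epsilon>"
    using res[unfolded oblivious_resilient_def, rule_format, of E] E by simp
  then obtain D where D: "\<And>m e. m \<in> M \<Longrightarrow> e \<in> E \<Longrightarrow>
      measure_pmf.prob (pmf_of_set R) {\<rho>. D (Enc (m, \<rho>) + e, \<rho>) = m} \<ge> 1 - \<epsilon>"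
    by auto
  have "real (card (M \<times> E)) * (1 - \<epsilon>) \<le> real (card X)"
  proof (rule card_mult_le_if_prob_ge[OF R,
      where P = "\<lambda>p \<rho>. D (Enc (fst p, \<rho>) + snd p, \<rho>) = fst p"])
    fix \<rho> assume \<rho>: "\<rho> \<in> R"
    let ?A = "{p \<in> M \<times> E. D (Enc (fst p, \<rho>) + snd p, \<rho>) = fst p}"
    let ?f = "\<lambda>p. Enc (fst p, \<rho>) + snd p"
    have "inj_on ?f ?A"
      \<comment> \<open>On \<open>?A\<close> decoding x returns the message; subtracting its
        codeword under the same \<rho> then returns the error.\<close>
      by (rule inj_on_inverseI[where g = "\<lambda>x. (D (x, \<rho>), x - Enc (D (x, \<rho>), \<rho>))"]) auto
    moreover have "?f ` ?A \<subseteq> X"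
      using \<rho> code E(1) by (auto simp: private_code_def intro!: add)
    ultimately show "card ?A \<le> card X" using X card_inj_on_le by blast
  qed (use M fE D in auto)
  then show ?thesis by (simp add: card_cartesian_product)
qed

text \<open>A deterministic map f is turned into a channel by taking its graph as edge set. Right
  degrees are then fibre sizes, and f itself is a channel function. For fixed \<rho>, a correctly
  decoded message is determined by the output of f, which lies in \<open>Y\<close>.\<close>

lemma hamming_resilient_card_le:
  assumes R: "finite R" "R \<noteq> {}" and M: "finite M" and X: "finite X" "X \<noteq> {}" and Y: "finite Y"
    and code: "private_code M R X Enc" and res: "hamming_resilient M R X t \<epsilon> Enc"
    and f: "f \<in> X \<rightarrow> Y" and fibre: "\<And>y. y \<in> Y \<Longrightarrow> real (card {x \<in> X. f x = y}) \<le> 2 powr t"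
  shows "real (card M) * (1 - \<epsilon>) \<le> real (card Y)"
proof -
  define G where "G = {(x, f x) | x. x \<in> X}"
  have nb: "{x \<in> X. (x, y) \<in> G} = {x \<in> X. f x = y}" for y by (auto simp: G_def)
  have "hamming_channel X Y G" using f by (auto simp: hamming_channel_def G_def)
  moreover have "real (distortion X Y G) \<le> 2 powr t"
  proof -
    \<comment> \<open>Nonemptiness ensures that the \<open>Max\<close> in the distortion is
      attained, so the distortion is the size of an actual fibre.\<close>
    have "Y \<noteq> {}" using f X(2) by auto
    then have "distortion X Y G \<in> (\<lambda>y. card {x \<in> X. (x, y) \<in> G}) ` Y"
      unfolding distortion_def using Y by (intro Max_in) auto
    then show ?thesis using fibre by (auto simp: nb)
  qed
  ultimately have "decodable_over M R X \<epsilon> Enc Y G"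
    \<comment> \<open>The definition covers right sets of naturals only, while \<open>Y\<close> has
      an arbitrary type; below it consists of words.\<close>
    using hamming_resilient_any_type[OF res X] by blast
  moreover have "channel_function X Y G f" using f by (auto simp: channel_function_def G_def)
  ultimately obtain D where D: "\<And>m. m \<in> M \<Longrightarrow>
      measure_pmf.prob (pmf_of_set R) {\<rho>. D (f (Enc (m, \<rho>)), \<rho>) = m} \<ge> 1 - \<epsilon>"
    unfolding decodable_over_def by blast
  show ?thesis
  proof (rule card_mult_le_if_prob_ge[OF R M D])
    fix \<rho> assume \<rho>: "\<rho> \<in> R"
    let ?A = "{m \<in> M. D (f (Enc (m, \<rho>)), \<rho>) = m}"
    have "inj_on (\<lambda>m. f (Enc (m, \<rho>))) ?A"
      by (rule inj_on_inverseI[where g = "\<lambda>y. D (y, \<rho>)"]) simp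
    moreover have "(\<lambda>m. f (Enc (m, \<rho>))) ` ?A \<subseteq> Y"
      using \<rho> code f by (auto simp: private_code_def)
    ultimately show "card ?A \<le> card Y" using Y card_inj_on_le by blast
  qed
qed

text \<open>Words are the indicator functions of subsets of the first n positions, which reduces
  finiteness and counting to \<open>Pow\<close>.\<close>

lemma words_eq_image: "words n = (\<lambda>S i. of_bool (i \<in> S)) ` Pow {..<n}"
proof (intro equalityI subsetI)
  fix x assume x: "x \<in> words n"
  have "x = (\<lambda>i. of_bool (i \<in> {i. x i = 1}))" by (auto simp: fun_eq_iff of_bool_def)
  moreover have "{i. x i = 1} \<in> Pow {..<n}" using x by (auto simp: words_def not_less[symmetric])
  ultimately show "x \<in> (\<lambda>S i. of_bool (i \<in> S)) ` Pow {..<n}" by (rule image_eqI)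
qed (auto simp: words_def)

lemma finite_words: "finite (words n)"
  by (simp add: words_eq_image)

lemma card_words: "card (words n) = 2 ^ n"
proof -
  have "inj_on (\<lambda>S i. of_bool (i \<in> S) :: bit) (Pow {..<n})"
    by (rule inj_on_inverseI[where g = "\<lambda>x. {i. x i = 1}"]) simp
  then show ?thesis by (simp add: words_eq_image card_image card_Pow)
qed

text \<open>The value y fixes all positions from d on, so a word in the fibre is determined by its
  first d positions.\<close>

lemma card_words_shift_fibre_le: "card {x \<in> words n. (\<lambda>i. x (i + d)) = y} \<le> 2 ^ d"
proof -
  let ?A = "{x \<in> words n. (\<lambda>i. x (i + d)) = y}"
  let ?g = "\<lambda>x i. if i < d then x i else 0 :: bit"
  have "inj_on ?g ?A"
  proof (rule inj_onI)
    fix x x' assume A: "x \<in> ?A" "x' \<in> ?A" and g: "?g x = ?g x'"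
    have "x i = x' i" for i
    proof (cases "i < d")
      case True
      then show ?thesis using fun_cong[OF g, of i] by simp
    next
      case False
      have "(\<lambda>i. x (i + d)) = (\<lambda>i. x' (i + d))" using A by simp
      from fun_cong[OF this, of "i - d"] False show ?thesis by simp
    qed
    then show "x = x'" ..
  qed
  moreover have "?g ` ?A \<subseteq> words d" by (auto simp: words_def)
  ultimately have "card ?A \<le> card (words d)" using finite_words card_inj_on_le by blast
  then show ?thesis by (simp add: card_words)
qed

theorem theorem4p1:
  fixes n k :: nat and t \<epsilon> :: real and R :: "'r set"
    and Enc :: "(nat \<Rightarrow> bit) \<times> 'r \<Rightarrow> (nat \<Rightarrow> bit)"
  assumes "n \<ge> 1" and "0 \<le> t" and "t \<le> real n" and "0 < \<epsilon>" and "\<epsilon> < 1"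
    and "finite R" and "R \<noteq> {}"
    and "private_code (words k) R (words n) Enc"
    and "oblivious_resilient (words k) R (words n) t \<epsilon> Enc
       \<or> hamming_resilient (words k) R (words n) t \<epsilon> Enc"
  shows "real k / real n \<le> 1 - t / real n + (1 + log 2 (1 / (1 - \<epsilon>))) / real n"
proof -
  define d where "d = nat \<lfloor>t\<rfloor>"
  have d: "real d \<le> t" "t < real d + 1" using \<open>0 \<le> t\<close> unfolding d_def by linarith+
  then have dn: "d \<le> n" using \<open>t \<le> real n\<close> by linarith
  have pow: "real (2 ^ d) \<le> 2 powr t"
    using d(1) by (simp add: powr_realpow[symmetric])
  have main: "2 ^ k * 2 ^ d * (1 - \<epsilon>) \<le> (2 ^ n :: real)"
    using assms(9)
  proof
    assume res: "oblivious_resilient (words k) R (words n) t \<epsilon> Enc"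
    have "words d \<subseteq> words n" using dn by (auto simp: words_def)
    moreover have "x + y \<in> words n" if "x \<in> words n" "y \<in> words n" for x y
      using that by (simp add: words_def)
    ultimately show ?thesis
      using oblivious_resilient_card_le[OF assms(6,7) finite_words finite_words _ assms(8) res,
          of "words d"] pow
      by (simp add: card_words)
  next
    assume res: "hamming_resilient (words k) R (words n) t \<epsilon> Enc"
    let ?f = "\<lambda>x i. x (i + d) :: bit"
    have "words n \<noteq> {}" by (auto simp: words_eq_image)
    moreover have "?f \<in> words n \<rightarrow> words (n - d)" by (auto simp: words_def)
    moreover have "real (card {x \<in> words n. ?f x = y}) \<le> 2 powr t" for y
      using card_words_shift_fibre_le[of n d y] pow by (meson of_nat_mono order_trans)
    ultimately have "2 ^ k * (1 - \<epsilon>) \<le> (2 ^ (n - d) :: real)"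
      using hamming_resilient_card_le[OF assms(6,7) finite_words finite_words _ finite_words
          assms(8) res, of ?f "n - d"]
      by (simp add: card_words)
    \<comment> \<open>Since d \<le> n, the subtraction n - d is not truncated, and multiplying by
      2^d restores 2^n on the right.\<close>
    then have "2 ^ k * (1 - \<epsilon>) * 2 ^ d \<le> (2 ^ (n - d) * 2 ^ d :: real)"
      by (intro mult_right_mono) auto
    then show ?thesis using dn by (simp add: mult_ac flip: power_add)
  qed
  have "real k + real d + log 2 (1 - \<epsilon>) = log 2 (2 ^ k * 2 ^ d * (1 - \<epsilon>))"
    using \<open>\<epsilon> < 1\<close> by (simp add: log_mult log_nat_power)
  also have "\<dots> \<le> log 2 (2 ^ n)" using main \<open>\<epsilon> < 1\<close> by (intro log_mono) auto
  also have "\<dots> = real n" by simp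
  \<comment> \<open>Here - log (1 - \<epsilon>) becomes log (1 / (1 - \<epsilon>)), and t < d + 1
    replaces - d by - t + 1.\<close>
  finally have "real k \<le> real n - t + (1 + log 2 (1 / (1 - \<epsilon>)))"
    using d(2) \<open>\<epsilon> < 1\<close> by (simp add: log_divide)
  then have "real k / real n \<le> (real n - t + (1 + log 2 (1 / (1 - \<epsilon>)))) / real n"
    by (rule divide_right_mono) simp
  also have "\<dots> = 1 - t / real n + (1 + log 2 (1 / (1 - \<epsilon>))) / real n"
    using \<open>n \<ge> 1\<close> by (simp add: add_divide_distrib diff_divide_distrib)
  finally show ?thesis .
qed

end
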